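(* The group $\mathbb{Z} \wr \mathbb{Z}$ (restricted wreath product) is conjugacy separable but is not $p$-conjugacy separable for any prime $p$.
   Context: A group $G$ is conjugacy separable (resp. $p$-conjugacy separable) if for every pair of non-conjugate elements $g,h \in G$ there is a surjective homomorphism $\pi \colon G \to Q$ onto a finite group (resp. a finite $p$-group) $Q$ such that $\pi(g)$ and $\pi(h)$ are not conjugate in $Q$. The restricted wreath product is $A \wr B = \left(\bigoplus_{b \in B} A\right) \rtimes B$ with $B$ acting by $(b\cdot f)(x) = f(b^{-1}x)$ on finitely supported functions $f\colon B\to A$. *)

theory Defs
  imports "HOL-Algebra.Algebra"
begin

section \<open>Restricted wreath products\<close>

definition shift :: "('b, 'n) monoid_scheme \<Rightarrow> 'b \<Rightarrow> ('b \<Rightarrow> 'a) \<Rightarrow> 'b \<Rightarrow> 'a" where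
  "shift B b f = (\<lambda>x\<in>carrier B. f (inv\<^bsub>B\<^esub> b \<otimes>\<^bsub>B\<^esub> x))"

text \<open>
  The base group is the library's direct sum \<^const>\<open>sum_group\<close>: the extensional functions on the
  carrier of \<open>B\<close>, with values in the carrier of \<open>A\<close> and finite support, under pointwise
  multiplication.  The pair \<open>(f, b)\<close> stands for the element \<open>f b\<close> of the semidirect product, so
  that \<open>b f b\<^sup>-\<^sup>1\<close> is \<open>shift B b f\<close>.
\<close>

definition wreath_product ::
    "('a, 'm) monoid_scheme \<Rightarrow> ('b, 'n) monoid_scheme \<Rightarrow> (('b \<Rightarrow> 'a) \<times> 'b) monoid" where
  "wreath_product A B =
     (let S = sum_group (carrier B) (\<lambda>_. A) in
      \<lparr>carrier = carrier S \<times> carrier B,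
       monoid.mult = (\<lambda>(f, b) (g, c). (f \<otimes>\<^bsub>S\<^esub> shift B b g, b \<otimes>\<^bsub>B\<^esub> c)),
       one = (\<one>\<^bsub>S\<^esub>, \<one>\<^bsub>B\<^esub>)\<rparr>)"

lemma carrier_wreath_product:
  "carrier (wreath_product A B) =
     {f \<in> carrier B \<rightarrow>\<^sub>E carrier A. finite {x \<in> carrier B. f x \<noteq> \<one>\<^bsub>A\<^esub>}} \<times> carrier B"
  if "group A"
  using that by (simp add: wreath_product_def Let_def carrier_sum_group)

lemma mult_wreath_product:
  "(f, b) \<otimes>\<^bsub>wreath_product A B\<^esub> (g, c) =
     (\<lambda>x\<in>carrier B. f x \<otimes>\<^bsub>A\<^esub> g (inv\<^bsub>B\<^esub> b \<otimes>\<^bsub>B\<^esub> x), b \<otimes>\<^bsub>B\<^esub> c)"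
  by (simp add: wreath_product_def Let_def shift_def cong: restrict_cong)

lemma one_wreath_product:
  "\<one>\<^bsub>wreath_product A B\<^esub> = (\<lambda>x\<in>carrier B. \<one>\<^bsub>A\<^esub>, \<one>\<^bsub>B\<^esub>)"
  by (simp add: wreath_product_def Let_def)

lemma shift_closed:
  assumes "group A" "group B" "b \<in> carrier B" "f \<in> carrier (sum_group (carrier B) (\<lambda>_. A))"
  shows "shift B b f \<in> carrier (sum_group (carrier B) (\<lambda>_. A))"
proof -
  interpret B: group B by fact
  have f: "f \<in> carrier B \<rightarrow>\<^sub>E carrier A" "finite {x \<in> carrier B. f x \<noteq> \<one>\<^bsub>A\<^esub>}"
    using assms by (simp_all add: carrier_sum_group)
  have "{x \<in> carrier B. shift B b f x \<noteq> \<one>\<^bsub>A\<^esub>} \<subseteq> (\<lambda>y. b \<otimes>\<^bsub>B\<^esub> y) ` {x \<in> carrier B. f x \<noteq> \<one>\<^bsub>A\<^esub>}"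
  proof
    fix x assume x: "x \<in> {x \<in> carrier B. shift B b f x \<noteq> \<one>\<^bsub>A\<^esub>}"
    then have "x = b \<otimes>\<^bsub>B\<^esub> (inv\<^bsub>B\<^esub> b \<otimes>\<^bsub>B\<^esub> x)"
      using assms by (simp add: B.inv_solve_left' flip: B.m_assoc)
    then show "x \<in> (\<lambda>y. b \<otimes>\<^bsub>B\<^esub> y) ` {x \<in> carrier B. f x \<noteq> \<one>\<^bsub>A\<^esub>}"
      using x assms by (auto simp: shift_def)
  qed
  then have "finite {x \<in> carrier B. shift B b f x \<noteq> \<one>\<^bsub>A\<^esub>}"
    using f(2) finite_surj by blast
  moreover have "shift B b f \<in> carrier B \<rightarrow>\<^sub>E carrier A"
    using f(1) assms by (auto simp: shift_def PiE_iff)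
  ultimately show ?thesis using assms by (simp add: carrier_sum_group)
qed

lemma group_wreath_product:
  assumes "group A" "group B"
  shows "group (wreath_product A B)"
proof -
  interpret A: group A by fact
  interpret B: group B by fact
  define S where "S = sum_group (carrier B) (\<lambda>_. A)"
  interpret S: group S unfolding S_def using assms by simp
  have W: "carrier (wreath_product A B) = carrier S \<times> carrier B"
    "\<And>f b g c. (f, b) \<otimes>\<^bsub>wreath_product A B\<^esub> (g, c) = (f \<otimes>\<^bsub>S\<^esub> shift B b g, b \<otimes>\<^bsub>B\<^esub> c)"
    "\<one>\<^bsub>wreath_product A B\<^esub> = (\<one>\<^bsub>S\<^esub>, \<one>\<^bsub>B\<^esub>)"
    by (simp_all add: wreath_product_def Let_def S_def)
  have sc: "shift B b f \<in> carrier S" if "b \<in> carrier B" "f \<in> carrier S" for b f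
    using shift_closed[OF assms] that by (simp add: S_def)
  have sm: "shift B b (f \<otimes>\<^bsub>S\<^esub> g) = shift B b f \<otimes>\<^bsub>S\<^esub> shift B b g" if "b \<in> carrier B" for b f g
    using that by (auto simp: S_def shift_def fun_eq_iff)
  have ss: "shift B b (shift B c f) = shift B (b \<otimes>\<^bsub>B\<^esub> c) f" if "b \<in> carrier B" "c \<in> carrier B" for b c f
    using that by (auto simp: shift_def fun_eq_iff B.inv_mult_group B.m_assoc)
  have s1: "shift B \<one>\<^bsub>B\<^esub> f = f" if "f \<in> carrier S" for f
    using that assms by (auto simp: S_def shift_def fun_eq_iff carrier_sum_group PiE_iff extensional_def)
  have sone: "shift B b \<one>\<^bsub>S\<^esub> = \<one>\<^bsub>S\<^esub>" if "b \<in> carrier B" for b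
    using that by (auto simp: S_def shift_def fun_eq_iff)
  show ?thesis
  proof (rule groupI)
    fix x assume "x \<in> carrier (wreath_product A B)"
    then obtain f b where x: "x = (f, b)" "f \<in> carrier S" "b \<in> carrier B" by (auto simp: W)
    have "(shift B (inv\<^bsub>B\<^esub> b) (inv\<^bsub>S\<^esub> f), inv\<^bsub>B\<^esub> b) \<otimes>\<^bsub>wreath_product A B\<^esub> x = \<one>\<^bsub>wreath_product A B\<^esub>"
      using x by (simp add: W sone flip: sm)
    moreover have "(shift B (inv\<^bsub>B\<^esub> b) (inv\<^bsub>S\<^esub> f), inv\<^bsub>B\<^esub> b) \<in> carrier (wreath_product A B)"
      using x by (simp add: W sc)
    ultimately show "\<exists>y\<in>carrier (wreath_product A B). y \<otimes>\<^bsub>wreath_product A B\<^esub> x = \<one>\<^bsub>wreath_product A B\<^esub>"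
      by blast
  qed (auto simp: W sc sm ss s1 S.m_assoc B.m_assoc)
qed


section \<open>Conjugacy separability\<close>

definition conjugate :: "('a, 'm) monoid_scheme \<Rightarrow> 'a \<Rightarrow> 'a \<Rightarrow> bool" where
  "conjugate G g h \<longleftrightarrow> (\<exists>x\<in>carrier G. h = x \<otimes>\<^bsub>G\<^esub> g \<otimes>\<^bsub>G\<^esub> inv\<^bsub>G\<^esub> x)"

definition finite_group :: "('a, 'm) monoid_scheme \<Rightarrow> bool" where
  "finite_group G \<longleftrightarrow> group G \<and> finite (carrier G)"

definition finite_p_group :: "nat \<Rightarrow> ('a, 'm) monoid_scheme \<Rightarrow> bool" where
  "finite_p_group p G \<longleftrightarrow> finite_group G \<and> (\<exists>k. order G = p ^ k)"

text \<open>
  HOL cannot quantify over the type carrying \<open>Q\<close>, so \<open>Q\<close> ranges over the groups whose elements are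
  natural numbers.  Every finite group is isomorphic to one of these; accordingly, the introduction
  rules below accept a separating quotient of any type.
\<close>

definition conjugacy_separable :: "('a, 'm) monoid_scheme \<Rightarrow> bool" where
  "conjugacy_separable G \<longleftrightarrow>
     (\<forall>g\<in>carrier G. \<forall>h\<in>carrier G. \<not> conjugate G g h \<longrightarrow>
        (\<exists>(Q :: nat monoid) \<pi>. finite_group Q \<and> \<pi> \<in> epi G Q \<and> \<not> conjugate Q (\<pi> g) (\<pi> h)))"

definition p_conjugacy_separable :: "nat \<Rightarrow> ('a, 'm) monoid_scheme \<Rightarrow> bool" where
  "p_conjugacy_separable p G \<longleftrightarrow>
     (\<forall>g\<in>carrier G. \<forall>h\<in>carrier G. \<not> conjugate G g h \<longrightarrow>
        (\<exists>(Q :: nat monoid) \<pi>. finite_p_group p Q \<and> \<pi> \<in> epi G Q \<and> \<not> conjugate Q (\<pi> g) (\<pi> h)))"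

lemma separating_quotient_on_nat:
  fixes Q :: "('q, 'k) monoid_scheme" and G :: "('a, 'm) monoid_scheme"
  assumes "group G" "finite_group Q" "\<pi> \<in> epi G Q" "\<not> conjugate Q (\<pi> g) (\<pi> h)"
    and "g \<in> carrier G" "h \<in> carrier G"
  obtains Q' :: "nat monoid" and \<pi>' where "finite_group Q'" "order Q' = order Q"
    "\<pi>' \<in> epi G Q'" "\<not> conjugate Q' (\<pi>' g) (\<pi>' h)"
proof -
  interpret Q: group Q using assms by (simp add: finite_group_def)
  obtain e :: "'q \<Rightarrow> nat" where e: "inj_on e (carrier Q)"
    using assms(2) finite_imp_inj_to_nat_seg unfolding finite_group_def by blast
  define d where "d = inv_into (carrier Q) e"
  define Q' :: "nat monoid" where
    "Q' = \<lparr>carrier = e ` carrier Q, monoid.mult = (\<lambda>x y. e (d x \<otimes>\<^bsub>Q\<^esub> d y)), one = e \<one>\<^bsub>Q\<^esub>\<rparr>"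
  have de[simp]: "d (e x) = x" if "x \<in> carrier Q" for x
    using that e by (simp add: d_def)
  have gr: "group Q'"
  proof (rule groupI)
    fix x assume "x \<in> carrier Q'"
    then obtain q where q: "q \<in> carrier Q" "x = e q" by (auto simp: Q'_def)
    then show "\<exists>y\<in>carrier Q'. y \<otimes>\<^bsub>Q'\<^esub> x = \<one>\<^bsub>Q'\<^esub>"
      by (auto simp: Q'_def intro!: bexI[of _ "inv\<^bsub>Q\<^esub> q"])
  qed (auto simp: Q'_def Q.m_assoc)
  interpret Q': group Q' by (fact gr)
  have m: "e x \<otimes>\<^bsub>Q'\<^esub> e y = e (x \<otimes>\<^bsub>Q\<^esub> y)" if "x \<in> carrier Q" "y \<in> carrier Q" for x y
    using that by (simp add: Q'_def)
  have c: "carrier Q' = e ` carrier Q" by (simp add: Q'_def)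
  have i: "inv\<^bsub>Q'\<^esub> (e x) = e (inv\<^bsub>Q\<^esub> x)" if "x \<in> carrier Q" for x
    using that by (intro Q'.inv_equality) (auto simp: c m, auto simp: Q'_def)
  have \<pi>: "\<pi> x \<in> carrier Q" if "x \<in> carrier G" for x
    using assms(3) that by (auto simp: epi_def hom_def)
  show thesis
  proof
    show "finite_group Q'" using gr assms(2) by (simp add: finite_group_def c)
    show "order Q' = order Q" using e by (simp add: order_def c card_image)
    show "e \<circ> \<pi> \<in> epi G Q'"
      using assms(3) by (simp add: epi_def hom_def c m Pi_iff flip: image_image)
    show "\<not> conjugate Q' ((e \<circ> \<pi>) g) ((e \<circ> \<pi>) h)"
    proof
      assume "conjugate Q' ((e \<circ> \<pi>) g) ((e \<circ> \<pi>) h)"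
      then obtain x where x: "x \<in> carrier Q" "e (\<pi> h) = e (x \<otimes>\<^bsub>Q\<^esub> \<pi> g \<otimes>\<^bsub>Q\<^esub> inv\<^bsub>Q\<^esub> x)"
        using \<pi> assms(5) by (auto simp: conjugate_def c i m)
      then have "\<pi> h = x \<otimes>\<^bsub>Q\<^esub> \<pi> g \<otimes>\<^bsub>Q\<^esub> inv\<^bsub>Q\<^esub> x"
        using e \<pi> assms(5,6) by (auto dest: inj_onD)
      then show False using x assms(4) by (auto simp: conjugate_def)
    qed
  qed
qed

lemma conjugacy_separableI:
  fixes G :: "('a, 'm) monoid_scheme"
  assumes "group G"
    and "\<And>g h. \<lbrakk>g \<in> carrier G; h \<in> carrier G; \<not> conjugate G g h\<rbrakk> \<Longrightarrow>
           \<exists>(Q :: 'q monoid) \<pi>. finite_group Q \<and> \<pi> \<in> epi G Q \<and> \<not> conjugate Q (\<pi> g) (\<pi> h)"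
  shows "conjugacy_separable G"
  unfolding conjugacy_separable_def
  using assms(2) separating_quotient_on_nat[OF assms(1)] by metis

lemma p_conjugacy_separableI:
  fixes G :: "('a, 'm) monoid_scheme"
  assumes "group G"
    and "\<And>g h. \<lbrakk>g \<in> carrier G; h \<in> carrier G; \<not> conjugate G g h\<rbrakk> \<Longrightarrow>
           \<exists>(Q :: 'q monoid) \<pi>. finite_p_group p Q \<and> \<pi> \<in> epi G Q \<and> \<not> conjugate Q (\<pi> g) (\<pi> h)"
  shows "p_conjugacy_separable p G"
  unfolding p_conjugacy_separable_def finite_p_group_def
  using assms(2)[unfolded finite_p_group_def] separating_quotient_on_nat[OF assms(1)] by metis

end

theory Submission
  imports Defs
begin

text \<open>
  Read a finitely supported \<open>f :: int \<Rightarrow> int\<close> as the Laurent polynomial \<open>\<Sum>x. f x t\<^sup>x\<close>.  Then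
  \<open>\<int> \<wr> \<int>\<close> is the semidirect product of \<open>R = \<int>[t, t\<^sup>-\<^sup>1]\<close> with the infinite cyclic group
  generated by multiplication with \<open>t\<close>, and \<open>(f, b)\<close> is conjugate to \<open>(f', b')\<close> if and only if
  \<open>b = b'\<close> and \<open>f' = t\<^sup>c f + (1 - t\<^sup>b) g\<close> for some integer \<open>c\<close> and some \<open>g\<close> in \<open>R\<close>
  (\<open>conjugate_Z_wr_Z_iff\<close>).

  Conjugacy separability: reducing exponents modulo \<open>n\<close> and coefficients modulo \<open>m\<close> maps the group
  onto the finite group \<open>\<int>/m \<wr> \<int>/n\<close>.  If \<open>b \<noteq> b'\<close>, a large \<open>n\<close> separates the two elements.  If
  \<open>b = b'\<close>, take \<open>n\<close> dividing \<open>b\<close>.  The two images then lie in the abelian base group, where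
  conjugation is just cyclic shift (\<open>conjugate_base_imp_shift\<close>), and for large \<open>m\<close> conjugacy of the
  images says that \<open>f'\<close> equals a shift of \<open>f\<close> in \<open>\<int>[t]/(t\<^sup>n - 1)\<close>.  For \<open>b \<noteq> 0\<close> and \<open>n = \<bar>b\<bar>\<close> this
  quotient ring is \<open>R/(1 - t\<^sup>b)\<close>, so that the original elements are conjugate
  (\<open>class_sums_eq_imp_conjugate\<close>).  For \<open>b = 0\<close> every \<open>n\<close> is admissible, and if \<open>n\<close> is large
  compared with the supports then equality in the quotient ring gives equality in \<open>R\<close>
  (\<open>class_sums_eq_imp_conjugate_base\<close>).

  Failure for a prime \<open>p\<close>: let \<open>q > 1\<close> be prime to \<open>p\<close>.  The elements \<open>(0, q)\<close> and \<open>(1 - t, q)\<close> are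
  not conjugate, because \<open>1 - t\<^sup>q\<close> does not divide \<open>1 - t\<close> in \<open>R\<close>.  In a quotient of order
  \<open>p\<^sup>k\<close>, however, the image of \<open>t\<close> equals that of \<open>t\<^bsup>qs\<^esup>\<close> when \<open>s\<close> inverts \<open>q\<close> modulo
  \<open>p\<^sup>k\<close>.  So the second element has the same image as \<open>(1 - t\<^bsup>qs\<^esup>, q)\<close>, which is conjugate to
  \<open>(0, q)\<close> since \<open>1 - t\<^sup>q\<close> divides \<open>1 - t\<^bsup>qs\<^esup>\<close>.
\<close>

section \<open>Conjugation in wreath products\<close>

abbreviation Z_wr_Z :: "((int \<Rightarrow> int) \<times> int) monoid" where
  "Z_wr_Z \<equiv> wreath_product integer_group integer_group"

lemma carrier_Z_wr_Z: "carrier Z_wr_Z = {f. finite {x. f x \<noteq> 0}} \<times> UNIV"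
  by (simp add: carrier_wreath_product)

lemma mult_Z_wr_Z: "(f, b) \<otimes>\<^bsub>Z_wr_Z\<^esub> (g, c) = (\<lambda>x. f x + g (x - b), b + c)"
  by (simp add: mult_wreath_product restrict_UNIV)

lemma group_Z_wr_Z: "group Z_wr_Z"
  by (simp add: group_wreath_product)

text \<open>
  This form of conjugacy avoids computing inverses in a wreath product.
\<close>

lemma conjugate_iff_intertwined:
  assumes "group G" "g \<in> carrier G" "h \<in> carrier G"
  shows "conjugate G g h \<longleftrightarrow> (\<exists>x\<in>carrier G. h \<otimes>\<^bsub>G\<^esub> x = x \<otimes>\<^bsub>G\<^esub> g)"
proof -
  interpret group G by fact
  have "h = x \<otimes>\<^bsub>G\<^esub> g \<otimes>\<^bsub>G\<^esub> inv\<^bsub>G\<^esub> x \<longleftrightarrow> h \<otimes>\<^bsub>G\<^esub> x = x \<otimes>\<^bsub>G\<^esub> g" if "x \<in> carrier G" for x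
    using assms that by (metis inv_solve_right m_closed)
  then show ?thesis by (auto simp: conjugate_def)
qed

lemma conjugate_hom:
  assumes "group G" "group H" "\<pi> \<in> hom G H" "g \<in> carrier G" "h \<in> carrier G" "conjugate G g h"
  shows "conjugate H (\<pi> g) (\<pi> h)"
proof -
  obtain x where x: "x \<in> carrier G" "h \<otimes>\<^bsub>G\<^esub> x = x \<otimes>\<^bsub>G\<^esub> g"
    using assms conjugate_iff_intertwined by metis
  then have "\<pi> h \<otimes>\<^bsub>H\<^esub> \<pi> x = \<pi> x \<otimes>\<^bsub>H\<^esub> \<pi> g"
    using assms by (metis hom_mult)
  then show ?thesis
    using assms x(1) conjugate_iff_intertwined[OF assms(2)] by (metis hom_in_carrier)
qed

lemma conjugate_Z_wr_Z_iff:
  assumes "finite {x. f x \<noteq> 0}" "finite {x. f' x \<noteq> 0}"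
  shows "conjugate Z_wr_Z (f, b) (f', b') \<longleftrightarrow>
           b = b' \<and> (\<exists>c g. finite {x. g x \<noteq> 0} \<and> (\<forall>x. f' x = f (x - c) + g x - g (x - b)))"
    (is "?lhs \<longleftrightarrow> ?rhs")
proof -
  have "?lhs \<longleftrightarrow> (\<exists>x\<in>carrier Z_wr_Z. (f', b') \<otimes>\<^bsub>Z_wr_Z\<^esub> x = x \<otimes>\<^bsub>Z_wr_Z\<^esub> (f, b))"
    using assms by (intro conjugate_iff_intertwined[OF group_Z_wr_Z]) (auto simp: carrier_Z_wr_Z)
  also have "\<dots> \<longleftrightarrow> (\<exists>g c. finite {x. g x \<noteq> 0} \<and>
      (f', b') \<otimes>\<^bsub>Z_wr_Z\<^esub> (g, c) = (g, c) \<otimes>\<^bsub>Z_wr_Z\<^esub> (f, b))"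
    by (auto simp: carrier_Z_wr_Z)
  also have "\<dots> \<longleftrightarrow> ?rhs"
    by (auto simp: mult_Z_wr_Z fun_eq_iff algebra_simps)
  finally show ?thesis .
qed

lemma conjugate_imp_same_top:
  assumes "group A" "comm_group B"
    and "(f, b) \<in> carrier (wreath_product A B)" "(f', b') \<in> carrier (wreath_product A B)"
    and "conjugate (wreath_product A B) (f, b) (f', b')"
  shows "b = b'"
proof -
  interpret B: comm_group B by fact
  have W: "group (wreath_product A B)" using assms(1) B.group_axioms by (rule group_wreath_product)
  obtain g c where gc: "(g, c) \<in> carrier (wreath_product A B)"
    "(f', b') \<otimes>\<^bsub>wreath_product A B\<^esub> (g, c) = (g, c) \<otimes>\<^bsub>wreath_product A B\<^esub> (f, b)"
    using assms(5) unfolding conjugate_iff_intertwined[OF W assms(3,4)] by fastforce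
  have top: "b \<in> carrier B" "b' \<in> carrier B" "c \<in> carrier B"
    using assms(3,4) gc(1) by (auto simp: carrier_wreath_product[OF assms(1)])
  have "b' \<otimes>\<^bsub>B\<^esub> c = c \<otimes>\<^bsub>B\<^esub> b" using gc(2) by (simp add: mult_wreath_product)
  also have "\<dots> = b \<otimes>\<^bsub>B\<^esub> c" using top by (simp add: B.m_comm)
  finally show ?thesis using top by simp
qed

text \<open>
  An element of an abelian base group commutes with the base group, so only the top group
  contributes to its conjugates.
\<close>

lemma conjugate_base_imp_shift:
  assumes "comm_group A" "group B" "(f, \<one>\<^bsub>B\<^esub>) \<in> carrier (wreath_product A B)"
    and "(f', \<one>\<^bsub>B\<^esub>) \<in> carrier (wreath_product A B)"
    and "conjugate (wreath_product A B) (f, \<one>\<^bsub>B\<^esub>) (f', \<one>\<^bsub>B\<^esub>)"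
  obtains c where "c \<in> carrier B" "\<And>x. x \<in> carrier B \<Longrightarrow> f' x = f (inv\<^bsub>B\<^esub> c \<otimes>\<^bsub>B\<^esub> x)"
proof -
  interpret A: comm_group A by fact
  interpret B: group B by fact
  have W: "group (wreath_product A B)" by (rule group_wreath_product) unfold_locales
  obtain g c where gc: "(g, c) \<in> carrier (wreath_product A B)"
    "(f', \<one>\<^bsub>B\<^esub>) \<otimes>\<^bsub>wreath_product A B\<^esub> (g, c) = (g, c) \<otimes>\<^bsub>wreath_product A B\<^esub> (f, \<one>\<^bsub>B\<^esub>)"
    using assms(5) unfolding conjugate_iff_intertwined[OF W assms(3,4)] by fastforce
  note car = carrier_wreath_product[OF A.group_axioms, of B]
  have c: "c \<in> carrier B" using gc(1) by (simp add: car)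
  have "f' x = f (inv\<^bsub>B\<^esub> c \<otimes>\<^bsub>B\<^esub> x)" if x: "x \<in> carrier B" for x
  proof -
    have "f' x \<otimes>\<^bsub>A\<^esub> g x = g x \<otimes>\<^bsub>A\<^esub> f (inv\<^bsub>B\<^esub> c \<otimes>\<^bsub>B\<^esub> x)"
      using gc(2) x by (auto simp: mult_wreath_product fun_eq_iff restrict_def split: if_splits)
    moreover have "f' x \<in> carrier A" "g x \<in> carrier A" "f (inv\<^bsub>B\<^esub> c \<otimes>\<^bsub>B\<^esub> x) \<in> carrier A"
      using assms(3,4) gc(1) x c by (auto simp: car)
    ultimately show ?thesis by (metis A.m_comm A.r_cancel)
  qed
  with c show thesis by (rule that)
qed


section \<open>Sums over residue classes\<close>

text \<open>
  These are the coefficients of the image of \<open>f\<close> in \<open>\<int>[t]/(t\<^sup>n - 1)\<close>.  The argument \<open>r\<close> is any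
  representative of its class, so that shifts need no normalisation.
\<close>

definition class_sum :: "nat \<Rightarrow> (int \<Rightarrow> int) \<Rightarrow> int \<Rightarrow> int" where
  "class_sum n f r = (\<Sum>x | f x \<noteq> 0 \<and> x mod int n = r mod int n. f x)"

lemma class_sum_eq_sum:
  assumes "finite A" "{x. f x \<noteq> 0} \<subseteq> A"
  shows "class_sum n f r = (\<Sum>x\<in>A. if x mod int n = r mod int n then f x else 0)"
proof -
  have "class_sum n f r = (\<Sum>x | x \<in> A \<and> x mod int n = r mod int n. f x)"
    unfolding class_sum_def using assms by (intro sum.mono_neutral_left) auto
  then show ?thesis using assms(1) by (simp add: sum.inter_filter)
qed

lemma class_sum_add:
  assumes "finite {x. f x \<noteq> 0}" "finite {x. g x \<noteq> 0}"
  shows "class_sum n (\<lambda>x. f x + g x) r = class_sum n f r + class_sum n g r"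
proof -
  define A where "A = {x. f x \<noteq> 0} \<union> {x. g x \<noteq> 0}"
  have A: "finite A" using assms by (simp add: A_def)
  have "class_sum n (\<lambda>x. f x + g x) r = (\<Sum>x\<in>A. if x mod int n = r mod int n then f x + g x else 0)"
    using A by (rule class_sum_eq_sum) (auto simp: A_def)
  also have "\<dots> = (\<Sum>x\<in>A. if x mod int n = r mod int n then f x else 0) +
      (\<Sum>x\<in>A. if x mod int n = r mod int n then g x else 0)"
    unfolding sum.distrib[symmetric] by (intro sum.cong) auto
  also have "\<dots> = class_sum n f r + class_sum n g r"
    using class_sum_eq_sum[OF A, of f n r] class_sum_eq_sum[OF A, of g n r] by (simp add: A_def)
  finally show ?thesis .
qed

lemma class_sum_uminus: "class_sum n (\<lambda>x. - f x) r = - class_sum n f r"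
  by (simp add: class_sum_def sum_negf)

lemma class_sum_mod [simp]: "class_sum n f (r mod int n) = class_sum n f r"
  by (simp add: class_sum_def)

lemma class_sum_shift: "class_sum n (\<lambda>x. f (x - c)) r = class_sum n f (r - c)"
  unfolding class_sum_def
  by (rule sum.reindex_bij_witness[where i = "\<lambda>x. x + c" and j = "\<lambda>x. x - c"])
     (auto simp: mod_eq_dvd_iff algebra_simps)

lemma finite_support_shift:
  fixes f :: "int \<Rightarrow> int"
  assumes "finite {x. f x \<noteq> 0}"
  shows "finite {x. f (x - c) \<noteq> 0}"
proof -
  have "{x. f (x - c) \<noteq> 0} = (\<lambda>x. x + c) ` {x. f x \<noteq> 0}"
    by (auto simp: image_iff) (metis diff_add_cancel)
  with assms show ?thesis by simp
qed

lemma finite_support_add: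
  fixes f g :: "int \<Rightarrow> int"
  assumes "finite {x. f x \<noteq> 0}" "finite {x. g x \<noteq> 0}"
  shows "finite {x. f x + g x \<noteq> 0}"
  by (rule finite_subset[of _ "{x. f x \<noteq> 0} \<union> {x. g x \<noteq> 0}"]) (use assms in auto)

lemma finite_support_bounded:
  fixes f :: "int \<Rightarrow> int"
  assumes "finite {x. f x \<noteq> 0}"
  obtains L where "\<And>x. f x \<noteq> 0 \<Longrightarrow> \<bar>x\<bar> \<le> L"
  using assms by (force simp: finite_int_iff_bounded_le)

lemma abs_class_sum_le:
  assumes "finite {x. f x \<noteq> 0}"
  shows "\<bar>class_sum n f r\<bar> \<le> (\<Sum>x | f x \<noteq> 0. \<bar>f x\<bar>)"
proof -
  have "\<bar>class_sum n f r\<bar> \<le> (\<Sum>x | f x \<noteq> 0 \<and> x mod int n = r mod int n. \<bar>f x\<bar>)"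
    unfolding class_sum_def by (rule sum_abs)
  moreover have "\<dots> \<le> (\<Sum>x | f x \<noteq> 0. \<bar>f x\<bar>)"
    using assms by (intro sum_mono2) auto
  ultimately show ?thesis by linarith
qed

text \<open>
  A window shorter than \<open>n\<close> meets each residue class at most once.
\<close>

lemma class_sum_window:
  assumes "\<And>x. f x \<noteq> 0 \<Longrightarrow> \<bar>x\<bar> \<le> M" "2 * M < int n" "\<bar>y\<bar> \<le> M"
  shows "class_sum n f y = f y"
proof -
  have "x = y" if "f x \<noteq> 0" "x mod int n = y mod int n" for x
  proof (rule ccontr)
    assume "x \<noteq> y"
    moreover have "int n dvd x - y" using that(2) by (simp add: mod_eq_dvd_iff)
    ultimately have "int n \<le> \<bar>x - y\<bar>" using zdvd_imp_le[of "int n" "\<bar>x - y\<bar>"] by auto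
    then show False using assms(1)[OF that(1)] assms(2,3) by linarith
  qed
  then have "{x. f x \<noteq> 0 \<and> x mod int n = y mod int n} = (if f y = 0 then {} else {y})"
    by auto
  then show ?thesis by (simp add: class_sum_def)
qed

text \<open>
  The class sums determine the residue of \<open>h\<close> modulo \<open>1 - t\<^sup>n\<close>.  The quotient \<open>h / (1 - t\<^sup>n)\<close>,
  expanded as a series in increasing powers of \<open>t\<close>, has as coefficients the partial sums of \<open>h\<close>
  along the residue classes; the vanishing of the total sums makes it a Laurent polynomial.
\<close>

lemma vanishing_class_sums_imp_difference:
  assumes fin: "finite {x. h x \<noteq> 0}" and zero: "\<And>r. class_sum n h r = 0" and n: "n > 0"
  obtains g where "finite {x. g x \<noteq> 0}" "\<And>x. h x = g x - g (x - int n)"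
proof
  define g where "g x = (\<Sum>y | h y \<noteq> 0 \<and> y mod int n = x mod int n \<and> y \<le> x. h y)" for x
  obtain L where L: "\<And>x. h x \<noteq> 0 \<Longrightarrow> \<bar>x\<bar> \<le> L"
    using finite_support_bounded[OF fin] by blast
  show "finite {x. g x \<noteq> 0}"
  proof (rule finite_subset)
    show "{x. g x \<noteq> 0} \<subseteq> {-L..L}"
    proof
      fix x assume x: "x \<in> {x. g x \<noteq> 0}"
      have "x \<ge> - L"
      proof (rule ccontr)
        assume "\<not> x \<ge> - L"
        then have "{y. h y \<noteq> 0 \<and> y mod int n = x mod int n \<and> y \<le> x} = {}" using L by fastforce
        then have "g x = 0" unfolding g_def by (simp only: sum.empty)
        with x show False by simp
      qed
      moreover have "x \<le> L"
      proof (rule ccontr)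
        assume "\<not> x \<le> L"
        then have "{y. h y \<noteq> 0 \<and> y mod int n = x mod int n \<and> y \<le> x} = {y. h y \<noteq> 0 \<and> y mod int n = x mod int n}"
          using L by fastforce
        with x zero[of x] show False by (simp add: g_def class_sum_def)
      qed
      ultimately show "x \<in> {-L..L}" by simp
    qed
  qed simp
  show "h x = g x - g (x - int n)" for x
  proof -
    \<comment> \<open>Within one class, lowering the bound by \<open>n\<close> drops exactly the summand at \<open>x\<close>.\<close>
    have below: "y \<le> x - int n \<longleftrightarrow> y \<le> x \<and> y \<noteq> x" if "y mod int n = x mod int n" for y
    proof -
      have "int n dvd x - y" using that by (simp add: mod_eq_dvd_iff dvd_diff_commute)
      then have "x - y > 0 \<Longrightarrow> int n \<le> x - y" by (rule zdvd_imp_le)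
      then show ?thesis using n by auto
    qed
    have "g (x - int n) = (\<Sum>y \<in> {y. h y \<noteq> 0 \<and> y mod int n = x mod int n \<and> y \<le> x} - {x}. h y)"
      unfolding g_def using below by (intro sum.cong) auto
    also have "\<dots> = g x - h x"
      unfolding g_def using fin by (subst sum_diff1) auto
    finally show ?thesis by simp
  qed
qed


section \<open>Reduction to a finite wreath product\<close>

abbreviation mod_wreath :: "nat \<Rightarrow> nat \<Rightarrow> ((int \<Rightarrow> int) \<times> int) monoid" where
  "mod_wreath m n \<equiv> wreath_product (integer_mod_group m) (integer_mod_group n)"

definition reduction :: "nat \<Rightarrow> nat \<Rightarrow> (int \<Rightarrow> int) \<times> int \<Rightarrow> (int \<Rightarrow> int) \<times> int" where
  "reduction m n = (\<lambda>(f, b).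
     (\<lambda>r\<in>carrier (integer_mod_group n). class_sum n f r mod int m, b mod int n))"

lemma mod_in_carrier [simp]: "x mod int n \<in> carrier (integer_mod_group n)"
  by (simp add: carrier_integer_mod_group)

lemma finite_group_mod_wreath:
  assumes "m > 0" "n > 0"
  shows "finite_group (mod_wreath m n)"
proof -
  have "finite (carrier (mod_wreath m n))"
    using assms by (simp add: carrier_wreath_product carrier_integer_mod_group finite_PiE)
  then show ?thesis by (simp add: finite_group_def group_wreath_product)
qed

lemma reduction_epi:
  assumes "m > 0" "n > 0"
  shows "reduction m n \<in> epi Z_wr_Z (mod_wreath m n)"
proof -
  let ?N = "carrier (integer_mod_group n)"
  have N: "?N = {0..<int n}" and fN: "finite ?N" using assms by (auto simp: carrier_integer_mod_group)
  have "reduction m n \<in> hom Z_wr_Z (mod_wreath m n)"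
  proof (rule homI)
    fix x assume "x \<in> carrier Z_wr_Z"
    then show "reduction m n x \<in> carrier (mod_wreath m n)"
      using fN by (auto simp: reduction_def carrier_wreath_product)
  next
    fix x y assume "x \<in> carrier Z_wr_Z" "y \<in> carrier Z_wr_Z"
    then obtain f b g c where xy: "x = (f, b)" "y = (g, c)"
      "finite {x. f x \<noteq> 0}" "finite {x. g x \<noteq> 0}"
      by (auto simp: carrier_Z_wr_Z)
    have "class_sum n (\<lambda>x. f x + g (x - b)) r mod int m =
        (class_sum n f r mod int m + class_sum n g ((- (b mod int n) mod int n + r) mod int n) mod int m) mod int m" for r
    proof -
      have "(- (b mod int n) mod int n + r) mod int n = (r - b) mod int n"
        by (simp add: mod_simps)
      then have "class_sum n g ((- (b mod int n) mod int n + r) mod int n) = class_sum n g (r - b)"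
        by (metis class_sum_mod)
      then show ?thesis
        using xy(3,4) by (simp add: class_sum_add finite_support_shift class_sum_shift mod_simps)
    qed
    then show "reduction m n (x \<otimes>\<^bsub>Z_wr_Z\<^esub> y) = reduction m n x \<otimes>\<^bsub>mod_wreath m n\<^esub> reduction m n y"
      by (auto simp: xy reduction_def mult_Z_wr_Z mult_wreath_product fun_eq_iff restrict_def mod_simps)
  qed
  moreover from this have "reduction m n ` carrier Z_wr_Z \<subseteq> carrier (mod_wreath m n)"
    by (meson hom_in_carrier image_subsetI)
  moreover have "y \<in> reduction m n ` carrier Z_wr_Z" if yin: "y \<in> carrier (mod_wreath m n)" for y
  proof -
    obtain F b where y: "y = (F, b)" "F \<in> ?N \<rightarrow>\<^sub>E {0..<int m}" "b \<in> {0..<int n}"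
      using yin assms by (cases y) (auto simp: carrier_wreath_product carrier_integer_mod_group)
    define f where "f x = (if x \<in> ?N then F x else 0)" for x
    have fin: "finite {x. f x \<noteq> 0}"
      by (rule finite_subset[OF _ fN]) (auto simp: f_def)
    have "class_sum n f r = F r" if r: "r \<in> ?N" for r
    proof -
      have "class_sum n f r = (\<Sum>x\<in>?N. if x mod int n = r mod int n then f x else 0)"
        using fN by (rule class_sum_eq_sum) (auto simp: f_def)
      also have "\<dots> = (\<Sum>x\<in>?N. if x = r then f x else 0)"
        using r by (intro sum.cong) (auto simp: N)
      also have "\<dots> = F r" using fN r by (simp add: f_def)
      finally show ?thesis .
    qed
    then have "reduction m n (f, b) = y"
      using y by (auto simp: reduction_def fun_eq_iff restrict_def N PiE_iff extensional_def)
    moreover have "(f, b) \<in> carrier Z_wr_Z" using fin by (simp add: carrier_Z_wr_Z)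
    ultimately show ?thesis by (metis imageI)
  qed
  ultimately show ?thesis
    unfolding epi_def by blast
qed

lemma reduction_in_carrier:
  assumes "m > 0" "n > 0" "x \<in> carrier Z_wr_Z"
  shows "reduction m n x \<in> carrier (mod_wreath m n)"
  using reduction_epi[OF assms(1,2)] assms(3) unfolding epi_def by blast

lemma conjugate_reduction_imp_cong:
  assumes "m > 0" "n > 0" "(f, b) \<in> carrier Z_wr_Z" "(f', b') \<in> carrier Z_wr_Z"
    and "conjugate (mod_wreath m n) (reduction m n (f, b)) (reduction m n (f', b'))"
  shows "b mod int n = b' mod int n"
proof -
  note in_carrier = assms(3,4)[THEN reduction_in_carrier[OF assms(1,2)]]
  show ?thesis
    using in_carrier assms(5) unfolding reduction_def split_conv
    by (rule conjugate_imp_same_top[OF group_integer_mod_group abelian_integer_mod_group])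
qed

text \<open>
  When \<open>n\<close> divides \<open>b\<close>, both images lie in the base group.
\<close>

lemma conjugate_reduction_imp_shift:
  assumes "m > 0" "n > 0" "int n dvd b"
    and fin: "finite {x. f x \<noteq> 0}" "finite {x. f' x \<noteq> 0}"
    and "conjugate (mod_wreath m n) (reduction m n (f, b)) (reduction m n (f', b))"
  obtains c where "\<And>r. class_sum n f' r mod int m = class_sum n f (r - c) mod int m"
proof -
  let ?N = "carrier (integer_mod_group n)"
  define F F' where "F = (\<lambda>r\<in>?N. class_sum n f r mod int m)"
    and "F' = (\<lambda>r\<in>?N. class_sum n f' r mod int m)"
  have red: "reduction m n (f, b) = (F, \<one>\<^bsub>integer_mod_group n\<^esub>)"
    "reduction m n (f', b) = (F', \<one>\<^bsub>integer_mod_group n\<^esub>)"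
    using assms(3) by (auto simp: reduction_def F_def F'_def)
  have "(f, b) \<in> carrier Z_wr_Z" "(f', b) \<in> carrier Z_wr_Z"
    using fin by (simp_all add: carrier_Z_wr_Z)
  note in_carrier = this[THEN reduction_in_carrier[OF assms(1,2)], unfolded red]
  obtain c where c: "c \<in> ?N"
    "\<And>r. r \<in> ?N \<Longrightarrow> F' r = F (inv\<^bsub>integer_mod_group n\<^esub> c \<otimes>\<^bsub>integer_mod_group n\<^esub> r)"
    using conjugate_base_imp_shift[OF abelian_integer_mod_group group_integer_mod_group in_carrier]
      assms(6)[unfolded red] by blast
  show thesis
  proof
    fix r
    have "class_sum n f' r mod int m = F' (r mod int n)" by (simp add: F'_def)
    also have "\<dots> = F ((r - c) mod int n)"
      using c by (simp add: mod_simps)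
    also have "\<dots> = class_sum n f (r - c) mod int m" by (simp add: F_def)
    finally show "class_sum n f' r mod int m = class_sum n f (r - c) mod int m" .
  qed
qed


section \<open>Conjugacy separability\<close>

lemma class_sums_eq_imp_conjugate:
  assumes fin: "finite {x. f x \<noteq> 0}" "finite {x. f' x \<noteq> 0}" and "b \<noteq> 0"
    and eq: "\<And>r. class_sum (nat \<bar>b\<bar>) f' r = class_sum (nat \<bar>b\<bar>) f (r - c)"
  shows "conjugate Z_wr_Z (f, b) (f', b)"
proof -
  define h where "h x = f' x + - f (x - c)" for x
  have fin': "finite {x. - f (x - c) \<noteq> 0}" using finite_support_shift[OF fin(1)] by simp
  have "finite {x. h x \<noteq> 0}" unfolding h_def by (rule finite_support_add[OF fin(2) fin'])
  moreover have "class_sum (nat \<bar>b\<bar>) h r = 0" for r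
    unfolding h_def class_sum_add[OF fin(2) fin'] class_sum_uminus
    by (simp add: class_sum_shift eq)
  ultimately obtain g where g: "finite {x. g x \<noteq> 0}" "\<And>x. h x = g x - g (x - \<bar>b\<bar>)"
    using vanishing_class_sums_imp_difference[of h "nat \<bar>b\<bar>"] \<open>b \<noteq> 0\<close> by auto
  \<comment> \<open>For negative \<open>b\<close> use \<open>1 - t\<^bsup>-b\<^esup> = - t\<^bsup>-b\<^esup> (1 - t\<^sup>b)\<close>.\<close>
  define g' where "g' x = (if b > 0 then g x else - g (x + b))" for x
  have "finite {x. g' x \<noteq> 0}"
    using g(1) finite_support_shift[OF g(1), of "-b"] by (cases "b > 0") (simp_all add: g'_def)
  moreover have "f' x = f (x - c) + g' x - g' (x - b)" for x
    using g(2)[of x] by (auto simp: g'_def h_def)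
  ultimately show ?thesis
    using conjugate_Z_wr_Z_iff[OF fin, of b b] by blast
qed

text \<open>
  The shift \<open>c\<close> matters only modulo \<open>n\<close>.  Choose the representative that moves some support point of
  \<open>f\<close> onto a support point of \<open>f'\<close>: it is at most \<open>2L\<close> in absolute value, so the shifted \<open>f\<close> is
  supported in \<open>[-3L, 3L]\<close>, a window shorter than \<open>n\<close>.
\<close>

lemma class_sums_eq_imp_conjugate_base:
  assumes L: "\<And>x. f x \<noteq> 0 \<Longrightarrow> \<bar>x\<bar> \<le> L" "\<And>x. f' x \<noteq> 0 \<Longrightarrow> \<bar>x\<bar> \<le> L" and "6 * L < int n" "0 \<le> L"
    and eq: "\<And>r. class_sum n f' r = class_sum n f (r - c)"
  shows "conjugate Z_wr_Z (f, 0) (f', 0)"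
proof -
  have "{x. f x \<noteq> 0} \<subseteq> {-L..L}" "{x. f' x \<noteq> 0} \<subseteq> {-L..L}" using L by force+
  then have fin: "finite {x. f x \<noteq> 0}" "finite {x. f' x \<noteq> 0}"
    using finite_atLeastAtMost_int finite_subset by blast+
  obtain d where d: "d mod int n = c mod int n" "\<And>x. f x \<noteq> 0 \<Longrightarrow> \<bar>x + d\<bar> \<le> 3 * L"
  proof (cases "\<exists>y. f y \<noteq> 0")
    case True
    then obtain y where y: "f y \<noteq> 0" by blast
    have "class_sum n f' (y + c) = f y"
      using eq[of "y + c"] class_sum_window[of f L n y] L(1) y assms(3,4) by auto
    then have "{x. f' x \<noteq> 0 \<and> x mod int n = (y + c) mod int n} \<noteq> {}"
      using y unfolding class_sum_def by (metis sum.empty)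
    then obtain x where x: "f' x \<noteq> 0" "x mod int n = (y + c) mod int n" by blast
    show thesis
    proof (rule that[of "x - y"])
      show "(x - y) mod int n = c mod int n"
        using x(2) by (simp add: mod_eq_dvd_iff algebra_simps)
      show "\<bar>z + (x - y)\<bar> \<le> 3 * L" if "f z \<noteq> 0" for z
        using L(1)[OF that] L(1)[OF y] L(2)[OF x(1)] by linarith
    qed
  next
    case False
    then show thesis using that[of c] by blast
  qed
  define h where "h x = f' x + - f (x - d)" for x
  have fin': "finite {x. - f (x - d) \<noteq> 0}" using finite_support_shift[OF fin(1)] by simp
  have zero: "class_sum n h r = 0" for r
  proof -
    have "(r - d) mod int n = (r - c) mod int n" using d(1) by (metis mod_diff_right_eq)
    then have "class_sum n f (r - d) = class_sum n f (r - c)" by (metis class_sum_mod)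
    then show ?thesis
      unfolding h_def class_sum_add[OF fin(2) fin'] class_sum_uminus by (simp add: class_sum_shift eq)
  qed
  have supp: "\<bar>x\<bar> \<le> 3 * L" if "h x \<noteq> 0" for x
    using that L(2)[of x] d(2)[of "x - d"] \<open>0 \<le> L\<close> by (cases "f' x = 0") (auto simp: h_def)
  have "h x = 0" for x
    using class_sum_window[of h "3 * L" n x] supp zero assms(3) by (cases "h x = 0") auto
  then have "f' x = f (x - d) + 0 - 0" for x by (simp add: h_def algebra_simps)
  then show ?thesis
    unfolding conjugate_Z_wr_Z_iff[OF fin] by (intro conjI refl exI[of _ d] exI[of _ "\<lambda>_. 0"]) auto
qed

lemma conjugacy_separable_Z_wr_Z: "conjugacy_separable Z_wr_Z"
proof (rule conjugacy_separableI[OF group_Z_wr_Z, where ?'q = "(int \<Rightarrow> int) \<times> int"])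
  fix x y assume xy: "x \<in> carrier Z_wr_Z" "y \<in> carrier Z_wr_Z" "\<not> conjugate Z_wr_Z x y"
  then obtain f b f' b' where eqs: "x = (f, b)" "y = (f', b')"
    and fin: "finite {x. f x \<noteq> 0}" "finite {x. f' x \<noteq> 0}"
    by (auto simp: carrier_Z_wr_Z)
  have "\<exists>m n. m > 0 \<and> n > 0 \<and> \<not> conjugate (mod_wreath m n) (reduction m n x) (reduction m n y)"
  proof (cases "b = b'")
    case False
    define n where "n = nat (\<bar>b - b'\<bar> + 1)"
    have "b mod int n \<noteq> b' mod int n"
    proof
      assume "b mod int n = b' mod int n"
      then have "int n dvd \<bar>b - b'\<bar>" by (simp add: mod_eq_dvd_iff)
      then show False using False zdvd_imp_le[of "int n" "\<bar>b - b'\<bar>"] by (simp add: n_def)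
    qed
    moreover have "n > 0" by (simp add: n_def)
    ultimately have "\<not> conjugate (mod_wreath 1 n) (reduction 1 n x) (reduction 1 n y)"
      using conjugate_reduction_imp_cong[of 1 n f b f' b'] xy(1,2) by (auto simp: eqs)
    with \<open>n > 0\<close> show ?thesis by blast
  next
    case True
    obtain L1 where L1: "\<And>x. f x \<noteq> 0 \<Longrightarrow> \<bar>x\<bar> \<le> L1" using finite_support_bounded[OF fin(1)] by blast
    obtain L2 where L2: "\<And>x. f' x \<noteq> 0 \<Longrightarrow> \<bar>x\<bar> \<le> L2" using finite_support_bounded[OF fin(2)] by blast
    define L where "L = max 0 (max L1 L2)"
    have L: "\<And>x. f x \<noteq> 0 \<Longrightarrow> \<bar>x\<bar> \<le> L" "\<And>x. f' x \<noteq> 0 \<Longrightarrow> \<bar>x\<bar> \<le> L" "0 \<le> L"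
      using L1 L2 by (fastforce simp: L_def)+
    define n where "n = (if b = 0 then nat (6 * L + 1) else nat \<bar>b\<bar>)"
    define S where "S = (\<Sum>x | f x \<noteq> 0. \<bar>f x\<bar>) + (\<Sum>x | f' x \<noteq> 0. \<bar>f' x\<bar>)"
    define m where "m = nat (S + 1)"
    have "S \<ge> 0" by (auto simp: S_def intro!: add_nonneg_nonneg sum_nonneg)
    then have m: "m > 0" "int m = S + 1" by (auto simp: m_def)
    have n: "n > 0" "int n dvd b" using L(3) by (auto simp: n_def)
    have "\<not> conjugate (mod_wreath m n) (reduction m n x) (reduction m n y)"
    proof
      assume "conjugate (mod_wreath m n) (reduction m n x) (reduction m n y)"
      then obtain c where c: "\<And>r. class_sum n f' r mod int m = class_sum n f (r - c) mod int m"
        using conjugate_reduction_imp_shift[OF m(1) n fin] True by (auto simp: eqs)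
      \<comment> \<open>Class sums congruent modulo \<open>m\<close> agree, since they differ by at most \<open>S < m\<close>.\<close>
      have eq: "class_sum n f' r = class_sum n f (r - c)" for r
      proof (rule ccontr)
        let ?d = "\<bar>class_sum n f' r - class_sum n f (r - c)\<bar>"
        assume "class_sum n f' r \<noteq> class_sum n f (r - c)"
        moreover have "int m dvd ?d" using c[of r] by (simp add: mod_eq_dvd_iff)
        ultimately have "int m \<le> ?d" using zdvd_imp_le[of "int m" ?d] by auto
        moreover have "?d \<le> S"
          using abs_class_sum_le[OF fin(1), of n "r - c"] abs_class_sum_le[OF fin(2), of n r]
          by (simp add: S_def)
        ultimately show False using m(2) by linarith
      qed
      have "conjugate Z_wr_Z (f, b) (f', b)"
      proof (cases "b = 0")
        case True
        then show ?thesis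
          using class_sums_eq_imp_conjugate_base[OF L(1,2) _ L(3) eq] L(3) by (simp add: n_def)
      next
        case False
        then show ?thesis
          using class_sums_eq_imp_conjugate[OF fin False, of c] eq by (simp add: n_def)
      qed
      with xy(3) True show False by (simp add: eqs)
    qed
    with m(1) n(1) show ?thesis by blast
  qed
  then show "\<exists>(Q :: ((int \<Rightarrow> int) \<times> int) monoid) \<pi>.
      finite_group Q \<and> \<pi> \<in> epi Z_wr_Z Q \<and> \<not> conjugate Q (\<pi> x) (\<pi> y)"
    using finite_group_mod_wreath reduction_epi by metis
qed


section \<open>Failure of p-conjugacy separability\<close>

text \<open>
  The Laurent polynomial \<open>1 - t\<^sup>n\<close>.
\<close>

abbreviation difference :: "int \<Rightarrow> int \<Rightarrow> int" where
  "difference n \<equiv> (\<lambda>x. of_bool (x = 0) - of_bool (x = n))"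

lemma finite_support_difference: "finite {x. difference n x \<noteq> 0}"
  by (rule finite_subset[of _ "{0, n}"]) (auto simp: of_bool_def split: if_splits)

lemma conjugate_difference_multiple:
  assumes "q > 0"
  shows "conjugate Z_wr_Z (\<lambda>_. 0, int q) (difference (int q * int s), int q)"
proof -
  \<comment> \<open>The geometric sum \<open>1 + t\<^sup>q + \<dots> + t\<^bsup>q(s-1)\<^esup>\<close>, which is \<open>(1 - t\<^bsup>qs\<^esup>) / (1 - t\<^sup>q)\<close>.\<close>
  define g :: "int \<Rightarrow> int" where "g x = of_bool (int q dvd x \<and> 0 \<le> x \<and> x < int q * int s)" for x
  have "finite {x. g x \<noteq> 0}"
    by (rule finite_subset[of _ "{0..<int q * int s}"]) (auto simp: g_def)
  moreover have "difference (int q * int s) x = 0 + g x - g (x - int q)" for x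
  proof (cases "int q dvd x")
    case True
    then obtain k where k: "x = int q * k" by blast
    have "g (int q * j) = of_bool (0 \<le> j \<and> j < int s)" for j
      using assms by (simp add: g_def zero_le_mult_iff)
    from this[of k] this[of "k - 1"] have "g x = of_bool (0 \<le> k \<and> k < int s)"
      "g (x - int q) = of_bool (0 \<le> k - 1 \<and> k - 1 < int s)"
      by (simp_all add: k right_diff_distrib)
    moreover have "x = 0 \<longleftrightarrow> k = 0" "x = int q * int s \<longleftrightarrow> k = int s"
      using assms by (simp_all add: k)
    ultimately show ?thesis by (auto simp: of_bool_def)
  next
    case False
    then have "x \<noteq> 0" "x \<noteq> int q * int s" "\<not> int q dvd x - int q"
      by (auto simp: dvd_diff_left_iff)
    with False show ?thesis by (simp add: g_def)
  qed
  ultimately show ?thesis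
    by (subst conjugate_Z_wr_Z_iff)
      (simp, rule finite_support_difference, intro conjI refl exI[of _ 0] exI[of _ g] allI, simp_all only:)
qed

text \<open>
  Multiples of \<open>1 - t\<^sup>q\<close> have class sums zero, while for \<open>q \<ge> 2\<close> the two terms of \<open>1 - t\<close> lie in
  different classes.
\<close>

lemma not_conjugate_difference_one:
  assumes "q \<ge> 2"
  shows "\<not> conjugate Z_wr_Z (\<lambda>_. 0, int q) (difference 1, int q)"
proof
  assume "conjugate Z_wr_Z (\<lambda>_. 0, int q) (difference 1, int q)"
  then obtain g where g: "finite {x. g x \<noteq> 0}" "\<And>x. difference 1 x = g x - g (x - int q)"
    using finite_support_difference by (subst (asm) conjugate_Z_wr_Z_iff) auto
  have "class_sum q (difference 1) 0 = class_sum q (\<lambda>x. g x + - g (x - int q)) 0"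
    using g(2) by (metis (no_types, lifting) uminus_add_conv_diff add.commute)
  also have "\<dots> = class_sum q g 0 - class_sum q g (0 - int q)"
    using g(1) finite_support_shift[OF g(1), of "int q"]
    by (subst class_sum_add) (simp_all only: class_sum_uminus class_sum_shift, simp_all)
  also have "class_sum q g (0 - int q) = class_sum q g 0"
    using class_sum_mod[of q g "0 - int q"] class_sum_mod[of q g 0] by simp
  finally have "class_sum q (difference 1) 0 = 0" by simp
  moreover have "{x. difference 1 x \<noteq> 0 \<and> x mod int q = 0 mod int q} = {0}"
    using assms by (auto simp: of_bool_def split: if_splits)
  ultimately show False by (simp add: class_sum_def)
qed

text \<open>
  Here \<open>n\<close> enters only through the translations by \<open>n\<close> and \<open>- n\<close>.  Hence the image under a
  homomorphism depends on \<open>n\<close> only through the images of these translations.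
\<close>

lemma difference_factorization:
  "(difference n, c) = (\<lambda>x. of_bool (x = 0), 0) \<otimes>\<^bsub>Z_wr_Z\<^esub> (\<lambda>_. 0, n) \<otimes>\<^bsub>Z_wr_Z\<^esub>
      (\<lambda>x. - of_bool (x = 0), c) \<otimes>\<^bsub>Z_wr_Z\<^esub> (\<lambda>_. 0, - n)"
  by (auto simp: mult_Z_wr_Z)

lemma hom_translation_cong:
  assumes "group Q" "finite (carrier Q)" "\<pi> \<in> hom Z_wr_Z Q" "int (order Q) dvd a - b"
  shows "\<pi> (\<lambda>_. 0, a) = \<pi> (\<lambda>_. 0, b)"
proof -
  interpret Q: group Q by fact
  define \<tau> where "\<tau> c = \<pi> (\<lambda>_. 0, c)" for c :: int
  have \<tau>: "\<tau> \<in> hom integer_group Q"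
  proof (rule homI)
    show "\<tau> c \<in> carrier Q" for c
      using assms(3) by (auto simp: \<tau>_def carrier_Z_wr_Z elim!: hom_in_carrier)
    show "\<tau> (c \<otimes>\<^bsub>integer_group\<^esub> d) = \<tau> c \<otimes>\<^bsub>Q\<^esub> \<tau> d" for c d
      using hom_mult[OF assms(3), of "(\<lambda>_. 0, c)" "(\<lambda>_. 0, d)"]
      by (simp add: \<tau>_def carrier_Z_wr_Z mult_Z_wr_Z)
  qed
  have car: "\<tau> c \<in> carrier Q" for c using hom_in_carrier[OF \<tau>] by simp
  obtain k where k: "a = b + int (order Q) * k" using assms(4) by (auto simp: dvd_def algebra_simps)
  have "\<tau> (int (order Q) * k) = \<tau> k [^]\<^bsub>Q\<^esub> order Q"
    using group_hom.hom_nat_pow[of integer_group Q \<tau> k "order Q"] \<tau>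
    by (simp add: group_hom_def group_hom_axioms_def)
  also have "\<dots> = \<one>\<^bsub>Q\<^esub>" using car by (rule Q.pow_order_eq_1)
  finally have "\<tau> a = \<tau> b"
    using hom_mult[OF \<tau>, of b "int (order Q) * k"] car by (simp add: k)
  then show ?thesis by (simp add: \<tau>_def)
qed

lemma not_p_conjugacy_separable_Z_wr_Z:
  assumes "p \<ge> 1"
  shows "\<not> p_conjugacy_separable p Z_wr_Z"
proof
  \<comment> \<open>Any number greater than 1 and prime to \<open>p\<close> would do.\<close>
  define q where "q = p + 1"
  let ?g = "(\<lambda>_. 0, int q) :: (int \<Rightarrow> int) \<times> int"
  let ?h = "\<lambda>n. (difference n, int q)"
  have car: "?g \<in> carrier Z_wr_Z" "?h n \<in> carrier Z_wr_Z" for n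
    using finite_support_difference by (auto simp: carrier_Z_wr_Z)
  assume "p_conjugacy_separable p Z_wr_Z"
  then obtain Q :: "nat monoid" and \<pi> where Q: "finite_p_group p Q" "\<pi> \<in> epi Z_wr_Z Q"
    "\<not> conjugate Q (\<pi> ?g) (\<pi> (?h 1))"
    using car not_conjugate_difference_one[of q] assms unfolding p_conjugacy_separable_def q_def
    by fastforce
  then obtain k where k: "order Q = p ^ k" and gr: "group Q" and fin: "finite (carrier Q)"
    by (auto simp: finite_p_group_def finite_group_def)
  have hom: "\<pi> \<in> hom Z_wr_Z Q" using Q(2) by (simp add: epi_def)
  have "coprime q (p ^ k)" by (simp add: q_def)
  then obtain u v where uv: "u * int q + v * int (p ^ k) = 1"
    using bezout_int[of "int q" "int (p ^ k)"] by (metis coprime_imp_gcd_eq_1 coprime_int_iff)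
  define s where "s = nat (u mod int (p ^ k))"
  have s: "int s = u - int (p ^ k) * (u div int (p ^ k))"
    using assms by (simp add: s_def minus_mult_div_eq_mod)
  have "int q * int s - 1 = int (order Q) * (- v - int q * (u div int (p ^ k)))"
    unfolding s using uv by (simp add: k algebra_simps)
  then have "int (order Q) dvd int q * int s - 1" by simp
  moreover from this have "int (order Q) dvd - (int q * int s) - (- 1)"
    by (metis dvd_minus_iff minus_diff_minus)
  ultimately have "\<pi> (\<lambda>_. 0, int q * int s) = \<pi> (\<lambda>_. 0, 1)"
    "\<pi> (\<lambda>_. 0, - (int q * int s)) = \<pi> (\<lambda>_. 0, - 1)"
    using hom_translation_cong[OF gr fin hom] by blast+
  moreover have "\<pi> (?h n) = \<pi> (\<lambda>x. of_bool (x = 0), 0) \<otimes>\<^bsub>Q\<^esub> \<pi> (\<lambda>_. 0, n) \<otimes>\<^bsub>Q\<^esub>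
      \<pi> (\<lambda>x. - of_bool (x = 0), int q) \<otimes>\<^bsub>Q\<^esub> \<pi> (\<lambda>_. 0, - n)" for n
  proof -
    interpret W: group Z_wr_Z by (rule group_Z_wr_Z)
    have "(\<lambda>x. of_bool (x = 0), 0) \<in> carrier Z_wr_Z" "(\<lambda>x. - of_bool (x = 0), int q) \<in> carrier Z_wr_Z"
      "(\<lambda>_. 0, n) \<in> carrier Z_wr_Z" "(\<lambda>_. 0, - n) \<in> carrier Z_wr_Z"
      by (auto simp: carrier_Z_wr_Z)
    then show ?thesis
      unfolding difference_factorization by (simp only: hom_mult[OF hom] W.m_closed)
  qed
  ultimately have "\<pi> (?h (int q * int s)) = \<pi> (?h 1)" by simp
  moreover have "conjugate Q (\<pi> ?g) (\<pi> (?h (int q * int s)))"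
    using conjugate_hom[OF group_Z_wr_Z gr hom car(1) car(2)] conjugate_difference_multiple[of q s]
    by (simp add: q_def)
  ultimately show False using Q(3) by simp
qed

theorem corollary1p2:
  shows "conjugacy_separable (wreath_product integer_group integer_group) \<and>
         (\<forall>p::nat. Factorial_Ring.prime p \<longrightarrow>
            \<not> p_conjugacy_separable p (wreath_product integer_group integer_group))"
  using conjugacy_separable_Z_wr_Z not_p_conjugacy_separable_Z_wr_Z prime_ge_1_nat by blast

end
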